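(* Let $(X,\to,0,1)$ be an involutive BE algebra. Then $X$ is an implicative-orthomodular algebra if and only if for all $x,y,z\in X$, $$x\to (y\Cap (z\Cap x))=(x\to y)\Cap (x\to z).$$
   Context: A BE algebra is an algebra $(X,\to,1)$ of type $(2,0)$ such that for all $x,y,z\in X$: $x\to x=1$; $x\to 1=1$; $1\to x=x$; $x\to(y\to z)=y\to(x\to z)$. Put $x\le y$ iff $x\to y=1$. It is bounded if there is $0\in X$ with $0\le x$ for all $x\in X$; then $x^*:=x\to 0$. It is involutive if it is bounded and $x^{**}=x$ for all $x$. In an involutive BE algebra $(X,\to,0,1)$ define $x\Cap y:=((x^*\to y^* )\to y^* )^*$. An implicative-orthomodular algebra (IOM algebra) is an involutive BE algebra satisfying $x\Cap(y\to x)=x$ for all $x,y\in X$. *)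

theory Defs
  imports Main
begin

text \<open>
  The underlying set of the algebra is a type \<open>'a\<close> (nonempty, as is every BE algebra since it
  contains \<open>1\<close>), and its operations are explicit parameters.
\<close>

locale BE_algebra =
  fixes imp :: "'a \<Rightarrow> 'a \<Rightarrow> 'a" (infixr "\<rightarrow>" 60)
    and one :: 'a ("\<one>")
  assumes imp_self: "x \<rightarrow> x = \<one>"
    and imp_one: "x \<rightarrow> \<one> = \<one>"
    and one_imp: "\<one> \<rightarrow> x = x"
    and imp_exchange: "x \<rightarrow> (y \<rightarrow> z) = y \<rightarrow> (x \<rightarrow> z)"
begin

definition le :: "'a \<Rightarrow> 'a \<Rightarrow> bool" (infix "\<preceq>" 50)
  where "x \<preceq> y \<longleftrightarrow> x \<rightarrow> y = \<one>"

end

text \<open>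
  \<open>\<preceq>\<close> need not be antisymmetric, so a bottom element need not be unique; it is part of the
  signature of a bounded algebra.
\<close>

locale bounded_BE_algebra = BE_algebra +
  fixes zero :: 'a ("\<zero>")
  assumes zero_le: "\<zero> \<preceq> x"
begin

definition compl :: "'a \<Rightarrow> 'a" ("_\<^sup>\<star>" [1000] 999)
  where "x\<^sup>\<star> = x \<rightarrow> \<zero>"

end

locale involutive_BE_algebra = bounded_BE_algebra +
  assumes compl_compl: "(x\<^sup>\<star>)\<^sup>\<star> = x"
begin

text \<open>
  \<open>\<sqinter>\<close> stands for the operation usually written as a double-struck cap; it need not be commutative.
\<close>

definition cap :: "'a \<Rightarrow> 'a \<Rightarrow> 'a" (infixl "\<sqinter>" 70)
  where "x \<sqinter> y = ((x\<^sup>\<star> \<rightarrow> y\<^sup>\<star>) \<rightarrow> y\<^sup>\<star>)\<^sup>\<star>"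

end

locale IOM_algebra = involutive_BE_algebra +
  assumes cap_imp: "x \<sqinter> (y \<rightarrow> x) = x"

end

theory Submission
  imports Defs
begin

text \<open>
  In an involutive BE algebra the product \<open>a \<odot> b = (a \<rightarrow> b\<^sup>\<star>)\<^sup>\<star>\<close> is commutative and
  associative, and \<open>x \<rightarrow> y = (x \<odot> y\<^sup>\<star>)\<^sup>\<star>\<close>, \<open>x \<sqinter> y = (x\<^sup>\<star> \<odot> y)\<^sup>\<star> \<odot> y\<close>. So everything
  can be computed in a commutative semigroup with an involution. There the orthomodular axiom
  becomes the law \<open>L\<close>: \<open>(w \<odot> (v \<odot> w)\<^sup>\<star>)\<^sup>\<star> \<odot> (v \<odot> w)\<^sup>\<star> = w\<^sup>\<star>\<close>
  (lemma \<open>IOM_iff_prod_law\<close>).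

  Put \<open>p = x \<rightarrow> z\<close> and \<open>a = (x \<rightarrow> y) \<sqinter> p\<close>. Then \<open>z \<sqinter> x = x \<odot> p\<close>, and in the
  same way \<open>y \<sqinter> (z \<sqinter> x) = x \<odot> a\<close>, so the distributive identity just says
  \<open>x \<rightarrow> x \<odot> a = a\<close> (lemma \<open>cap_cap_eq_prod\<close>). For \<open>y = \<zero>\<close> it reads
  \<open>x\<^sup>\<star> = x\<^sup>\<star> \<sqinter> (x \<rightarrow> z)\<close>, which by contraposition is the orthomodular axiom for
  \<open>x\<^sup>\<star>\<close>.

  Conversely, call \<open>u\<close> below \<open>v\<close> when \<open>u \<sqinter> v = u\<close>. Two uses of \<open>L\<close> show that
  \<open>x\<^sup>\<star>\<close> is below \<open>a\<close> (lemma \<open>compl_cap_imp_cap_imp\<close>), and a third one turns this into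
  \<open>x \<rightarrow> x \<odot> a = a\<close> (lemma \<open>imp_prod_cancel\<close>).
\<close>

context involutive_BE_algebra
begin

definition prod :: "'a \<Rightarrow> 'a \<Rightarrow> 'a" (infixl "\<odot>" 75)
  where "a \<odot> b = (a \<rightarrow> b\<^sup>\<star>)\<^sup>\<star>"

lemma imp_contrapositive: "x\<^sup>\<star> \<rightarrow> y\<^sup>\<star> = y \<rightarrow> x"
proof -
  have "x\<^sup>\<star> \<rightarrow> y\<^sup>\<star> = y \<rightarrow> (x\<^sup>\<star>)\<^sup>\<star>"
    unfolding compl_def by (rule imp_exchange)
  then show ?thesis by (simp add: compl_compl)
qed

lemma imp_eq_prod: "x \<rightarrow> y = (x \<odot> y\<^sup>\<star>)\<^sup>\<star>"
  by (simp add: prod_def compl_compl)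

lemma prod_commute: "a \<odot> b = b \<odot> a"
  unfolding prod_def compl_def by (subst imp_exchange) simp

lemma prod_left_commute: "a \<odot> (b \<odot> c) = b \<odot> (a \<odot> c)"
  unfolding prod_def compl_compl by (subst imp_exchange) simp

lemma prod_assoc: "(a \<odot> b) \<odot> c = a \<odot> (b \<odot> c)"
  by (metis prod_commute prod_left_commute)

lemmas prod_ac = prod_assoc prod_commute prod_left_commute

lemma cap_eq_prod: "x \<sqinter> y = (x\<^sup>\<star> \<odot> y)\<^sup>\<star> \<odot> y"
  by (simp add: cap_def prod_def compl_compl)

lemma zero_cap: "\<zero> \<sqinter> y = \<zero>"
proof -
  have "\<zero>\<^sup>\<star> = \<one>" and "\<one>\<^sup>\<star> = \<zero>"
    by (simp_all add: compl_def imp_self one_imp)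
  then show ?thesis
    by (simp add: cap_def one_imp imp_self)
qed

text \<open>
  The orthomodular axiom for \<open>x\<close> and \<open>y\<close> is this law at \<open>w = x\<^sup>\<star>\<close> and \<open>v = y\<close>.
\<close>

lemma IOM_iff_prod_law:
  "IOM_algebra imp one zero \<longleftrightarrow>
    (\<forall>v w. (w \<odot> (v \<odot> w)\<^sup>\<star>)\<^sup>\<star> \<odot> (v \<odot> w)\<^sup>\<star> = w\<^sup>\<star>)"
proof -
  have "IOM_algebra imp one zero \<longleftrightarrow> (\<forall>x y. x \<sqinter> (y \<rightarrow> x) = x)"
    by (simp add: IOM_algebra_def IOM_algebra_axioms_def involutive_BE_algebra_axioms)
  also have "\<dots> \<longleftrightarrow> (\<forall>v w. w\<^sup>\<star> \<sqinter> (v \<rightarrow> w\<^sup>\<star>) = w\<^sup>\<star>)"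
    by (metis compl_compl)
  also have "\<dots> \<longleftrightarrow> (\<forall>v w. (w \<odot> (v \<odot> w)\<^sup>\<star>)\<^sup>\<star> \<odot> (v \<odot> w)\<^sup>\<star> = w\<^sup>\<star>)"
    by (simp add: cap_eq_prod imp_eq_prod compl_compl)
  finally show ?thesis .
qed

text \<open>
  Since \<open>z \<sqinter> x = x \<odot> (x \<rightarrow> z)\<close>, the two outer caps have the common factor
  \<open>(x \<odot> y\<^sup>\<star> \<odot> (x \<rightarrow> z))\<^sup>\<star> \<odot> (x \<rightarrow> z)\<close>, and the left one has an additional factor \<open>x\<close>.
\<close>

lemma cap_cap_eq_prod: "y \<sqinter> (z \<sqinter> x) = x \<odot> ((x \<rightarrow> y) \<sqinter> (x \<rightarrow> z))"
  by (simp add: cap_eq_prod imp_eq_prod compl_compl prod_ac)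

end

context IOM_algebra
begin

lemma prod_law: "(w \<odot> (v \<odot> w)\<^sup>\<star>)\<^sup>\<star> \<odot> (v \<odot> w)\<^sup>\<star> = w\<^sup>\<star>"
  using IOM_iff_prod_law IOM_algebra_axioms by blast

text \<open>
  Each of \<open>x \<rightarrow> y\<close> and \<open>x \<rightarrow> z\<close> lies above \<open>x\<^sup>\<star>\<close>; although \<open>\<sqinter>\<close> is not a
  lattice meet, their cap stays above \<open>x\<^sup>\<star>\<close>.
\<close>

lemma compl_cap_imp_cap_imp: "x\<^sup>\<star> \<sqinter> ((x \<rightarrow> y) \<sqinter> (x \<rightarrow> z)) = x\<^sup>\<star>"
proof -
  define p where "p = x \<rightarrow> z"
  define s where "s = y\<^sup>\<star> \<odot> (x \<odot> p)"
  have cap: "(x \<rightarrow> y) \<sqinter> p = s\<^sup>\<star> \<odot> p"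
    by (simp add: s_def cap_eq_prod imp_eq_prod compl_compl prod_ac)
  have "x\<^sup>\<star> \<sqinter> (s\<^sup>\<star> \<odot> p) = ((x \<odot> p) \<odot> s\<^sup>\<star>)\<^sup>\<star> \<odot> s\<^sup>\<star> \<odot> p"
    by (simp add: cap_eq_prod compl_compl prod_ac)
  also have "((x \<odot> p) \<odot> s\<^sup>\<star>)\<^sup>\<star> \<odot> s\<^sup>\<star> = (x \<odot> p)\<^sup>\<star>"
    unfolding s_def by (rule prod_law)
  also have "(x \<odot> p)\<^sup>\<star> \<odot> p = x\<^sup>\<star>"
  proof -
    have "p = (z\<^sup>\<star> \<odot> x)\<^sup>\<star>"
      by (simp add: p_def imp_eq_prod prod_commute)
    then show ?thesis using prod_law by simp
  qed
  finally show ?thesis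
    by (simp add: cap flip: p_def)
qed

text \<open>
  The assumption exhibits \<open>x\<close> as \<open>(v \<odot> a)\<^sup>\<star>\<close> for \<open>v = (x \<odot> a)\<^sup>\<star>\<close>, so the product law at
  \<open>w = a\<close> applies with \<open>x\<close> in place of \<open>(v \<odot> w)\<^sup>\<star>\<close>.
\<close>

lemma imp_prod_cancel:
  assumes "x\<^sup>\<star> \<sqinter> a = x\<^sup>\<star>"
  shows "x \<rightarrow> x \<odot> a = a"
proof -
  have "(x \<odot> a)\<^sup>\<star> \<odot> a = x\<^sup>\<star>"
    using assms by (simp add: cap_eq_prod compl_compl)
  then have x: "((x \<odot> a)\<^sup>\<star> \<odot> a)\<^sup>\<star> = x"
    by (simp add: compl_compl)
  have "(a \<odot> x)\<^sup>\<star> \<odot> x = a\<^sup>\<star>"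
    using prod_law[of a "(x \<odot> a)\<^sup>\<star>"] unfolding x .
  then show ?thesis
    by (simp add: imp_eq_prod prod_commute compl_compl)
qed

lemma imp_cap_cap_distrib: "x \<rightarrow> (y \<sqinter> (z \<sqinter> x)) = (x \<rightarrow> y) \<sqinter> (x \<rightarrow> z)"
  unfolding cap_cap_eq_prod by (rule imp_prod_cancel[OF compl_cap_imp_cap_imp])

end

lemma (in involutive_BE_algebra) IOM_if_imp_cap_cap_distrib:
  assumes distrib: "\<And>x y z. x \<rightarrow> (y \<sqinter> (z \<sqinter> x)) = (x \<rightarrow> y) \<sqinter> (x \<rightarrow> z)"
  shows "IOM_algebra imp one zero"
proof unfold_locales
  fix x y
  have "x\<^sup>\<star> \<rightarrow> (\<zero> \<sqinter> (y\<^sup>\<star> \<sqinter> x\<^sup>\<star>)) = (x\<^sup>\<star> \<rightarrow> \<zero>) \<sqinter> (x\<^sup>\<star> \<rightarrow> y\<^sup>\<star>)"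
    by (rule distrib)
  then have "(x\<^sup>\<star>)\<^sup>\<star> = (x\<^sup>\<star>)\<^sup>\<star> \<sqinter> (x\<^sup>\<star> \<rightarrow> y\<^sup>\<star>)"
    by (simp add: zero_cap flip: compl_def)
  then show "x \<sqinter> (y \<rightarrow> x) = x"
    by (simp add: compl_compl imp_contrapositive)
qed

theorem theorem3p7:
  fixes imp :: "'a \<Rightarrow> 'a \<Rightarrow> 'a" (infixr "\<rightarrow>" 60)
    and cap :: "'a \<Rightarrow> 'a \<Rightarrow> 'a" (infixl "\<sqinter>" 70)
    and one zero :: 'a
  defines "cap \<equiv> involutive_BE_algebra.cap imp zero"
  assumes "involutive_BE_algebra imp one zero"
  shows "IOM_algebra imp one zero \<longleftrightarrow>
    (\<forall>x y z. x \<rightarrow> (y \<sqinter> (z \<sqinter> x)) = (x \<rightarrow> y) \<sqinter> (x \<rightarrow> z))"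
proof
  assume "IOM_algebra imp one zero"
  then show "\<forall>x y z. x \<rightarrow> (y \<sqinter> (z \<sqinter> x)) = (x \<rightarrow> y) \<sqinter> (x \<rightarrow> z)"
    unfolding cap_def by (simp add: IOM_algebra.imp_cap_cap_distrib)
next
  assume "\<forall>x y z. x \<rightarrow> (y \<sqinter> (z \<sqinter> x)) = (x \<rightarrow> y) \<sqinter> (x \<rightarrow> z)"
  then show "IOM_algebra imp one zero"
    unfolding cap_def
    by (intro involutive_BE_algebra.IOM_if_imp_cap_cap_distrib[OF assms(2)]) simp
qed

end
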